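(* Let $n\ge1$ be an integer and $r\ge1$ a real number such that $rn$ is an integer. Then (a) $(n,n,rn)\xrightarrow{\textsc{bm}}\left\lceil\dfrac{\lfloor 2r\rfloor n}{\lfloor 2r\rfloor+2}\right\rceil$, and (b) $(n,n,rn)\xrightarrow{\textsc{bm}}\left\lceil\dfrac{2rn}{\lceil 2r\rceil+2}\right\rceil$.
   Context: A hypergraph is identified with its finite edge set; a matching is a set of pairwise disjoint edges. A hypergraph $H$ is $k$-partite with sides $V_1,\ldots,V_k$ (a fixed partition of its vertex set) if $|e\cap V_t|=1$ for every edge $e$ and every $t$. For $f:H\to\mathbb{R}_{\ge0}$, $\deg_f(v)=\sum_{e\ni v}f(e)$; $f$ is balanced if $\deg_f$ is constant on each side. $H$ is $(b_1,\ldots,b_k)$-fractionally balanced if it is $k$-partite with sides of sizes $b_1,\ldots,b_k$ and has a nonzero balanced $f:H\to\mathbb{R}_{\ge0}$. $(b_1,\ldots,b_k)\xrightarrow{\textsc{bm}} m$ means every $(b_1,\ldots,b_k)$-fractionally balanced $k$-partite hypergraph has a matching of size $m$. *)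

theory Defs
  imports Complex_Main "HOL-Library.Disjoint_Sets"
begin

text \<open>A hypergraph is its finite set of edges. The sides of a \<open>k\<close>-partite hypergraph are
  given as a list of length \<open>k\<close> of vertex sets.\<close>

definition kpartite :: "'a set set \<Rightarrow> 'a set list \<Rightarrow> bool" where
  "kpartite H Vs \<longleftrightarrow>
     finite H \<and>
     (\<forall>t < length Vs. finite (Vs ! t)) \<and>
     (\<forall>s < length Vs. \<forall>t < length Vs. s \<noteq> t \<longrightarrow> Vs ! s \<inter> Vs ! t = {}) \<and>
     (\<forall>e \<in> H. e \<subseteq> \<Union> (set Vs) \<and> (\<forall>t < length Vs. card (e \<inter> Vs ! t) = 1))"

definition deg :: "'a set set \<Rightarrow> ('a set \<Rightarrow> real) \<Rightarrow> 'a \<Rightarrow> real" where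
  "deg H f v = (\<Sum>e \<in> {e \<in> H. v \<in> e}. f e)"

definition balanced :: "'a set set \<Rightarrow> 'a set list \<Rightarrow> ('a set \<Rightarrow> real) \<Rightarrow> bool" where
  "balanced H Vs f \<longleftrightarrow> (\<forall>t < length Vs. \<exists>c. \<forall>v \<in> Vs ! t. deg H f v = c)"

definition fractionally_balanced :: "nat list \<Rightarrow> 'a set set \<Rightarrow> bool" where
  "fractionally_balanced bs H \<longleftrightarrow>
     (\<exists>Vs. kpartite H Vs \<and> map card Vs = bs \<and>
        (\<exists>f. (\<forall>e \<in> H. f e \<ge> 0) \<and> (\<exists>e \<in> H. f e \<noteq> 0) \<and> balanced H Vs f))"

definition matching :: "'a set set \<Rightarrow> 'a set set \<Rightarrow> bool" where
  "matching H M \<longleftrightarrow> M \<subseteq> H \<and> disjoint M"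

text \<open>The type argument is the type of vertices: a definition cannot quantify over types, so
  "every hypergraph" is expressed by stating the relation for an arbitrary type \<open>'a\<close>.\<close>

definition bm_arrow :: "'a itself \<Rightarrow> nat list \<Rightarrow> nat \<Rightarrow> bool" where
  "bm_arrow _ bs m \<longleftrightarrow>
     (\<forall>H :: 'a set set. fractionally_balanced bs H \<longrightarrow> (\<exists>M. matching H M \<and> card M = m))"

end

theory Submission imports Defs "HOL-Library.Z2" begin

text \<open>
  Put \<open>k = \<lfloor>2r\<rfloor>\<close> or \<open>k = \<lceil>2r\<rceil>\<close> and scale the balanced function so that its degrees are a constant
  \<open>D \<le> k\<close> on the first side, at most \<open>k\<close> on the second and at most \<open>2\<close> on the third. The edges
  are coloured by their vertex on the first side, and a matching is a rainbow independent set in the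
  line graph of the bipartite graph formed by the other two sides. By the topological Hall theorem
  it suffices that the independence complex of the edges with colours in \<open>I\<close> is acyclic modulo 2 up to
  degree about \<open>D |I| / (k + 2)\<close>. Since the capacities \<open>k\<close> and \<open>2\<close> are integers, the weights on
  these edges may be replaced by integral ones of at least the same total; in Meshulam's
  deletion-explosion game, played in a suitable order, each explosion then destroys weight at most
  \<open>k + 2\<close> because every edge of positive weight has weight at least \<open>1\<close>.
\<close>

section \<open>Acyclicity of independence complexes\<close>

declare add_bit_eq_xor [simp del] mult_bit_eq_and [simp del]

text \<open>Chains modulo 2 are graded by the number of vertices, so degree \<open>0\<close> is spanned by the empty
  simplex and homology is reduced. The ground set \<open>U\<close> only serves to make the boundary a finite sum.\<close>

definition boundary :: "'v set \<Rightarrow> ('v set \<Rightarrow> bit) \<Rightarrow> 'v set \<Rightarrow> bit" where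
  "boundary U z s = (\<Sum>v \<in> U - s. z (insert v s))"

text \<open>The join with the vertex \<open>x\<close>: on chains avoiding \<open>x\<close> it adds
  \<open>x\<close> to every simplex.\<close>

definition cone :: "'v \<Rightarrow> ('v set \<Rightarrow> bit) \<Rightarrow> 'v set \<Rightarrow> bit" where
  "cone x z s = (if x \<in> s then z (s - {x}) else 0)"

definition chain_on :: "'v set set \<Rightarrow> nat \<Rightarrow> ('v set \<Rightarrow> bit) \<Rightarrow> bool" where
  "chain_on X j z \<longleftrightarrow> (\<forall>s. z s \<noteq> 0 \<longrightarrow> s \<in> X \<and> card s = j)"

text \<open>In the usual grading this says that reduced homology vanishes in dimensions up to
  \<open>m - 2\<close>. In particular, \<open>m = 1\<close> asks an independence complex to have a
  vertex.\<close>

definition acyclic_upto :: "'v set \<Rightarrow> nat \<Rightarrow> 'v set set \<Rightarrow> bool" where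
  "acyclic_upto U m X \<longleftrightarrow>
     (\<forall>j < m. \<forall>z. chain_on X j z \<and> boundary U z = (\<lambda>_. 0) \<longrightarrow>
        (\<exists>w. chain_on X (Suc j) w \<and> boundary U w = z))"

definition indep_sets :: "'v set \<Rightarrow> 'v rel \<Rightarrow> 'v set set" where
  "indep_sets V E = {s. s \<subseteq> V \<and> (\<forall>x \<in> s. \<forall>y \<in> s. (x, y) \<notin> E)}"

lemma bit_add_self [simp]: "a + a = (0 :: bit)" "a + (a + b) = (b :: bit)"
  by (cases a; cases b; simp)+

lemma chain_onD:
  assumes "chain_on X j z" "z s \<noteq> 0" shows "s \<in> X" "card s = j"
  using assms unfolding chain_on_def by auto

lemma chain_on_eq_0:
  assumes "chain_on X j z" "s \<notin> X" shows "z s = 0"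
  using assms unfolding chain_on_def by (metis bit_not_zero_iff)

lemma chain_on_add:
  assumes "chain_on X j z" "chain_on X j w" shows "chain_on X j (\<lambda>s. z s + w s)"
  using assms unfolding chain_on_def by (metis add_0)

lemma boundary_add: "boundary U (\<lambda>s. z s + w s) = (\<lambda>s. boundary U z s + boundary U w s)"
  by (simp add: boundary_def sum.distrib fun_eq_iff)

lemma acyclic_upto_mono: "acyclic_upto U m X \<Longrightarrow> m' \<le> m \<Longrightarrow> acyclic_upto U m' X"
  unfolding acyclic_upto_def by auto

text \<open>Removing the apex from a cone returns \<open>z\<close>, and removing any other vertex
  commutes with coning; modulo 2 there are no signs.\<close>

lemma boundary_cone:
  assumes "finite U" "x \<in> U" and off: "\<And>s. x \<in> s \<Longrightarrow> z s = 0"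
  shows "boundary U (cone x z) = (\<lambda>s. cone x (boundary U z) s + z s)"
proof
  fix s
  show "boundary U (cone x z) s = cone x (boundary U z) s + z s"
  proof (cases "x \<in> s")
    case True
    have "boundary U z (s - {x}) = (\<Sum>t \<in> insert x (U - s). z (insert t (s - {x})))"
      unfolding boundary_def using True assms by (intro sum.cong) auto
    also have "\<dots> = (\<Sum>t \<in> U - s. z (insert t (s - {x})))"
      using True assms by (subst sum.insert) auto
    also have "\<dots> = (\<Sum>t \<in> U - s. cone x z (insert t s))"
    proof (rule sum.cong)
      fix t assume "t \<in> U - s"
      then have "insert t s - {x} = insert t (s - {x})" using True by auto
      then show "z (insert t (s - {x})) = cone x z (insert t s)" using True by (simp add: cone_def)
    qed simp
    finally show ?thesis using True off by (simp add: cone_def boundary_def)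
  next
    case False
    have "boundary U (cone x z) s = (\<Sum>t \<in> U - s. if t = x then z s else 0)"
      unfolding boundary_def by (rule sum.cong) (use False in \<open>auto simp: cone_def\<close>)
    then show ?thesis using False assms by (simp add: cone_def)
  qed
qed

text \<open>An isolated vertex can be added to every independent set, so the complex is a cone with
  apex \<open>v\<close>. Coning the part of a cycle that avoids \<open>v\<close> fills the whole
  cycle.\<close>

lemma acyclic_upto_isolated:
  assumes "finite U" "V \<subseteq> U" "v \<in> V" and isol: "\<And>y. y \<in> V \<Longrightarrow> (v, y) \<notin> E \<and> (y, v) \<notin> E"
  shows "acyclic_upto U m (indep_sets V E)"
  unfolding acyclic_upto_def
proof (intro allI impI, elim conjE)
  fix j z assume z: "chain_on (indep_sets V E) j z" and cyc: "boundary U z = (\<lambda>_. 0)"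
  define z0 where "z0 s = (if v \<in> s then 0 else z s)" for s
  have vU: "v \<in> U" using assms by auto
  have "chain_on (indep_sets V E) (Suc j) (cone v z0)"
    unfolding chain_on_def
  proof (intro allI impI)
    fix s assume "cone v z0 s \<noteq> 0"
    then have vs: "v \<in> s" and "z (s - {v}) \<noteq> 0" by (auto simp: cone_def z0_def split: if_splits)
    from chain_onD[OF z this(2)] have I: "s - {v} \<in> indep_sets V E" and c: "card (s - {v}) = j" by auto
    have "finite s" using I assms by (metis (mono_tags, lifting) finite_subset indep_sets_def mem_Collect_eq finite_Diff2 finite.intros)
    then have "card s = Suc j" using vs c by (metis card_Suc_Diff1)
    moreover have "s \<in> indep_sets V E"
      using I isol vs \<open>v \<in> V\<close> unfolding indep_sets_def by blast
    ultimately show "s \<in> indep_sets V E \<and> card s = Suc j" by simp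
  qed
  moreover have "boundary U (cone v z0) = z"
  proof
    fix s
    have eq: "boundary U (cone v z0) s = cone v (boundary U z0) s + z0 s"
      by (subst boundary_cone[OF assms(1) vU]) (auto simp: z0_def)
    show "boundary U (cone v z0) s = z s"
    proof (cases "v \<in> s")
      case True
      have split: "U - (s - {v}) = insert v (U - s)" using True vU by auto
      have "boundary U z (s - {v}) = z s + (\<Sum>t \<in> U - s. z (insert t (s - {v})))"
        unfolding boundary_def split using True assms by (subst sum.insert) (auto simp: insert_absorb)
      moreover have "boundary U z0 (s - {v}) = (\<Sum>t \<in> U - s. z (insert t (s - {v})))"
        unfolding boundary_def split using True assms
        by (subst sum.insert) (auto simp: z0_def simp del: bit_not_zero_iff intro!: sum.cong)
      \<comment> \<open>The cycle condition at \<open>s - {v}\<close> determines the value of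
        \<open>z\<close> at a simplex through \<open>v\<close> from its values on simplices avoiding
        \<open>v\<close>.\<close>
      ultimately have "z s + boundary U z0 (s - {v}) = 0" using cyc by simp
      then have "boundary U z0 (s - {v}) = z s" by (metis bit_add_self(2) add.right_neutral)
      then show ?thesis using eq True by (simp add: cone_def z0_def)
    next
      case False
      then show ?thesis using eq by (simp add: cone_def z0_def)
    qed
  qed
  ultimately show "\<exists>w. chain_on (indep_sets V E) (Suc j) w \<and> boundary U w = z" by blast
qed

section \<open>Deletion and explosion of an edge\<close>

text \<open>Meshulam's deletion-explosion inequality. A cycle \<open>z\<close> bounds some \<open>w\<close> after the edge \<open>xy\<close> is
  deleted; the part of \<open>w\<close> above \<open>{x, y}\<close> is the join with a cycle \<open>u\<close> of the exploded graph, and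
  if \<open>u\<close> bounds \<open>v\<close> there, that part can be replaced by the suspension of \<open>v\<close>.\<close>

lemma acyclic_upto_explode:
  assumes fin: "finite U" and VU: "V \<subseteq> U" and xV: "x \<in> V" and yV: "y \<in> V"
    and xy: "(x, y) \<in> E" and symE: "sym E" and irr: "irrefl E"
    and del: "acyclic_upto U m (indep_sets V (E - {(x, y), (y, x)}))"
    and expl: "acyclic_upto U (m - 1) (indep_sets {z \<in> V. (x, z) \<notin> E \<and> (y, z) \<notin> E} E)"
  shows "acyclic_upto U m (indep_sets V E)"
  unfolding acyclic_upto_def
proof (intro allI impI, elim conjE)
  let ?X = "indep_sets V E" and ?D = "indep_sets V (E - {(x, y), (y, x)})"
  let ?S = "indep_sets {z \<in> V. (x, z) \<notin> E \<and> (y, z) \<notin> E} E"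
  fix j z assume "j < m" and z: "chain_on ?X j z" and cyc: "boundary U z = (\<lambda>_. 0)"
  have ne: "x \<noteq> y" using xy irr by (auto simp: irrefl_def)
  have U: "x \<in> U" "y \<in> U" using VU xV yV by auto
  have yx: "(y, x) \<in> E" using xy symE by (auto dest: symD)
  have XD: "?X \<subseteq> ?D" by (auto simp: indep_sets_def)
  have "chain_on ?D j z" using z XD by (auto simp: chain_on_def)
  then obtain w where w: "chain_on ?D (Suc j) w" and bw: "boundary U w = z"
    using del \<open>j < m\<close> cyc unfolding acyclic_upto_def by blast
  have fins: "finite s" if "s \<in> ?D" for s
    using that fin VU by (auto simp: indep_sets_def intro: finite_subset)
  have DX: "s \<in> ?X" if "s \<in> ?D" "\<not> (x \<in> s \<and> y \<in> s)" for s
    using that by (auto simp: indep_sets_def)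
  \<comment> \<open>The link of the edge in \<open>w\<close>, set to \<open>0\<close> on simplices
    meeting the edge, so that coning over \<open>y\<close> and \<open>x\<close> gives back exactly
    the part of \<open>w\<close> above the edge.\<close>
  define u where "u s = (if x \<in> s \<or> y \<in> s then 0 else w (insert x (insert y s)))" for s
  define w1 where "w1 s = (if x \<in> s \<and> y \<in> s then 0 else w s)" for s
  have w_split: "w = (\<lambda>s. w1 s + cone x (cone y u) s)"
  proof
    fix s show "w s = w1 s + cone x (cone y u) s"
    proof (cases "x \<in> s \<and> y \<in> s")
      case True
      then have "insert x (insert y (s - {x} - {y})) = s" by auto
      then show ?thesis using True ne by (simp add: w1_def cone_def u_def)
    next
      case False
      then show ?thesis using ne by (auto simp: w1_def cone_def)
    qed
  qed
  have w1: "chain_on ?X (Suc j) w1"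
    unfolding chain_on_def
  proof (intro allI impI)
    fix s assume "w1 s \<noteq> 0"
    then have "w s \<noteq> 0" "\<not> (x \<in> s \<and> y \<in> s)" by (auto simp: w1_def split: if_splits)
    then show "s \<in> ?X \<and> card s = Suc j" using chain_onD[OF w] DX by blast
  qed
  have uS: "s \<in> ?S \<and> Suc (card s) = j" if "u s \<noteq> 0" for s
  proof -
    have off: "x \<notin> s" "y \<notin> s" and "w (insert x (insert y s)) \<noteq> 0"
      using that by (auto simp: u_def split: if_splits)
    from chain_onD[OF w this(3)] have D: "insert x (insert y s) \<in> ?D"
      and c: "card (insert x (insert y s)) = Suc j" by auto
    have "finite s" using fins[OF D] by simp
    then have "Suc (card s) = j" using c off ne by simp
    moreover have "s \<in> ?S" using D off unfolding indep_sets_def by blast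
    ultimately show ?thesis by simp
  qed
  \<comment> \<open>The cycle \<open>z\<close> lives on independent sets and so has no simplex
    through the edge. Hence the boundary of \<open>w\<close> vanishes above \<open>{x, y}\<close>,
    where it agrees with the boundary of \<open>u\<close>.\<close>
  have bu: "boundary U u = (\<lambda>_. 0)"
  proof
    fix s
    show "boundary U u s = 0"
    proof (cases "x \<in> s \<or> y \<in> s")
      case True
      then show ?thesis unfolding boundary_def by (auto simp: u_def intro!: sum.neutral)
    next
      case False
      have "boundary U u s = (\<Sum>t \<in> U - insert x (insert y s). u (insert t s))"
        unfolding boundary_def using fin by (intro sum.mono_neutral_right) (auto simp: u_def)
      also have "\<dots> = boundary U w (insert x (insert y s))"
        unfolding boundary_def
      proof (rule sum.cong)
        fix t assume "t \<in> U - insert x (insert y s)"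
        then have "u (insert t s) = w (insert x (insert y (insert t s)))"
          using False by (auto simp: u_def)
        then show "u (insert t s) = w (insert t (insert x (insert y s)))"
          by (simp add: insert_commute)
      qed simp
      also have "\<dots> = 0" using xy by (subst bw, intro chain_on_eq_0[OF z]) (auto simp: indep_sets_def)
      finally show ?thesis .
    qed
  qed
  \<comment> \<open>For \<open>j = 0\<close> the simplices of \<open>w\<close> have one vertex and
    cannot contain the edge, so \<open>u\<close> is zero. Otherwise \<open>u\<close> has degree
    \<open>j - 1\<close>, which is below \<open>m - 1\<close>.\<close>
  have "\<exists>v. chain_on ?S j v \<and> boundary U v = u"
  proof (cases j)
    case 0
    then have "u = (\<lambda>_. 0)" using uS by (metis nat.distinct(1))
    then show ?thesis by (intro exI[of _ "\<lambda>_. 0"]) (simp add: chain_on_def boundary_def fun_eq_iff)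
  next
    case (Suc i)
    then have "chain_on ?S i u" using uS by (auto simp: chain_on_def)
    then show ?thesis using expl bu Suc \<open>j < m\<close> unfolding acyclic_upto_def by force
  qed
  then obtain v where v: "chain_on ?S j v" and bv: "boundary U v = u" by blast
  have voff: "v s = 0" if "x \<in> s \<or> y \<in> s" for s
    using that xy yx by (intro chain_on_eq_0[OF v]) (auto simp: indep_sets_def)
  have cone_chain: "chain_on ?X (Suc j) (cone a v)" if a: "a = x \<or> a = y" for a
    unfolding chain_on_def
  proof (intro allI impI)
    fix s assume "cone a v s \<noteq> 0"
    then have as: "a \<in> s" and nz: "v (s - {a}) \<noteq> 0" by (auto simp: cone_def split: if_splits)
    from chain_onD[OF v nz] have S: "s - {a} \<in> ?S" and c: "card (s - {a}) = j" by auto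
    have aE: "(a, a) \<notin> E" "a \<in> V" using irr a xV yV by (auto simp: irrefl_def)
    have na: "(a, t) \<notin> E \<and> (t, a) \<notin> E" if "t \<in> s - {a}" for t
      using S that a symE unfolding indep_sets_def by (auto dest: symD)
    have X: "s \<in> ?X" using S na aE as unfolding indep_sets_def by blast
    then have "finite s" using fins XD by blast
    then show "s \<in> ?X \<and> card s = Suc j" using X c as by (metis card_Suc_Diff1)
  qed
  \<comment> \<open>The boundary of the join of \<open>x\<close>, \<open>y\<close> and
    \<open>u\<close> is \<open>cone x u + cone y u\<close>, as \<open>u\<close> is a cycle. The
    suspension of \<open>v\<close> has the same boundary, because the two copies of \<open>v\<close>
    cancel, and no simplex of it contains the edge.\<close>
  let ?w = "\<lambda>s. w1 s + (cone x v s + cone y v s)"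
  have "chain_on ?X (Suc j) ?w"
    by (intro chain_on_add w1 cone_chain) auto
  moreover have "boundary U ?w = z"
  proof
    fix s
    have uoff: "u s = 0" if "x \<in> s \<or> y \<in> s" for s using that by (simp add: u_def)
    have "boundary U (cone y u) = (\<lambda>s. cone y (\<lambda>_. 0) s + u s)"
      by (subst boundary_cone) (use fin U uoff bu in auto)
    then have cyu: "boundary U (cone y u) = u" by (simp add: cone_def)
    have "boundary U (cone x (cone y u)) s = cone x u s + cone y u s"
      by (subst boundary_cone) (use fin U uoff ne cyu in \<open>auto simp: cone_def\<close>)
    moreover have "boundary U (cone x v) s = cone x u s + v s"
      "boundary U (cone y v) s = cone y u s + v s"
      by (subst boundary_cone; use fin U voff bv in simp)+
    moreover have "z s = boundary U w1 s + boundary U (cone x (cone y u)) s"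
      unfolding bw[symmetric] by (subst w_split) (simp add: boundary_add)
    ultimately show "boundary U ?w s = z s" by (simp add: boundary_add add_ac)
  qed
  ultimately show "\<exists>w. chain_on ?X (Suc j) w \<and> boundary U w = z" by blast
qed

section \<open>Rainbow independent sets\<close>

text \<open>A separate clique is a join with a discrete set, which raises acyclicity by one. With
  all edges from \<open>q\<close> into the clique removed, \<open>q\<close> is isolated; they are
  restored one by one, and exploding \<open>q\<close> and \<open>y\<close> kills the whole clique
  and leaves \<open>V\<close>.\<close>

lemma acyclic_upto_add_clique:
  assumes fin: "finite U" and VU: "V \<union> Q \<subseteq> U" and Q: "Q \<noteq> {}" and VQ: "V \<inter> Q = {}"
    and symE: "sym E" and irr: "irrefl E"
    and sep: "\<And>x y. x \<in> V \<Longrightarrow> y \<in> Q \<Longrightarrow> (x, y) \<notin> E"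
    and clique: "\<And>x y. x \<in> Q \<Longrightarrow> y \<in> Q \<Longrightarrow> x \<noteq> y \<Longrightarrow> (x, y) \<in> E"
    and acyc: "acyclic_upto U m (indep_sets V E)"
  shows "acyclic_upto U (Suc m) (indep_sets (V \<union> Q) E)"
proof -
  obtain q where q: "q \<in> Q" using Q by blast
  define F where "F R = E - ({q} \<times> (Q - R) \<union> (Q - R) \<times> {q})" for R
  have sep': "(y, x) \<notin> E" if "x \<in> V" "y \<in> Q" for x y
    using sep[OF that] symE by (meson symD)
  have "finite (Q - {q})" using fin VU by (meson finite_Diff finite_subset le_supE)
  then have "acyclic_upto U (Suc m) (indep_sets (V \<union> Q) (F (Q - {q})))"
  proof (rule finite_subset_induct'[OF _ subset_refl])
    show "acyclic_upto U (Suc m) (indep_sets (V \<union> Q) (F {}))"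
      by (rule acyclic_upto_isolated[OF fin VU, of q]) (use q sep sep' in \<open>auto simp: F_def\<close>)
  next
    fix y R assume R: "R \<subseteq> Q - {q}" and y: "y \<in> Q - {q}" "y \<notin> R"
      and IH: "acyclic_upto U (Suc m) (indep_sets (V \<union> Q) (F R))"
    have FR: "F (insert y R) - {(q, y), (y, q)} = F R" using y by (auto simp: F_def)
    have yq: "(q, y) \<in> E" "(y, q) \<in> E" using y q clique by auto
    have rest: "{z \<in> V \<union> Q. (q, z) \<notin> F (insert y R) \<and> (y, z) \<notin> F (insert y R)} = V"
    proof -
      have "(q, z) \<in> F (insert y R) \<or> (y, z) \<in> F (insert y R)" if "z \<in> Q" for z
        using that q y clique[of y z] yq by (cases "z = y") (auto simp: F_def)
      moreover have "(q, z) \<notin> F (insert y R)" "(y, z) \<notin> F (insert y R)" if "z \<in> V" for z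
        using that q y sep' by (auto simp: F_def)
      ultimately show ?thesis by blast
    qed
    have FV: "indep_sets V (F (insert y R)) = indep_sets V E"
      using q VQ by (auto simp: indep_sets_def F_def)
    show "acyclic_upto U (Suc m) (indep_sets (V \<union> Q) (F (insert y R)))"
    proof (rule acyclic_upto_explode[OF fin VU, of q y])
      show "sym (F (insert y R))" using symE by (auto simp: F_def sym_def)
      show "irrefl (F (insert y R))" using irr by (auto simp: F_def irrefl_def)
      show "(q, y) \<in> F (insert y R)" using yq y by (auto simp: F_def)
    qed (use q y IH acyc in \<open>simp_all only: FR rest FV diff_Suc_1, simp_all\<close>)
  qed
  moreover have "F (Q - {q}) = E" using irr by (auto simp: F_def irrefl_def)
  ultimately show ?thesis by simp
qed

text \<open>Every unordered pair is counted twice. This is the cancellation behind the vanishing of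
  a double boundary.\<close>

lemma sum_symmetric_pairs_bit:
  fixes g :: "'i \<Rightarrow> 'i \<Rightarrow> bit"
  assumes "finite I" and "\<And>i j. g i j = g j i"
  shows "(\<Sum>i \<in> I. \<Sum>j \<in> I - {i}. g i j) = 0"
  using assms(1)
proof (induction I)
  case (insert a I)
  have "(\<Sum>i \<in> I. \<Sum>j \<in> insert a I - {i}. g i j) = (\<Sum>i \<in> I. g i a + (\<Sum>j \<in> I - {i}. g i j))"
  proof (rule sum.cong)
    fix i assume "i \<in> I"
    then have "insert a I - {i} = insert a (I - {i})" using insert by auto
    then show "(\<Sum>j \<in> insert a I - {i}. g i j) = g i a + (\<Sum>j \<in> I - {i}. g i j)"
      using insert by simp
  qed simp
  also have "\<dots> = (\<Sum>i \<in> I. g a i)" using insert assms(2)[of _ a] by (simp add: sum.distrib)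
  finally show ?case using insert by simp
qed simp

lemma boundary_sum:
  "boundary U (\<lambda>s. \<Sum>i \<in> I. z i s) = (\<lambda>s. \<Sum>i \<in> I. boundary U (z i) s)"
  unfolding boundary_def by (rule ext) (rule sum.swap)

lemma chain_on_sum:
  assumes "\<And>i. i \<in> I \<Longrightarrow> chain_on X j (z i)" shows "chain_on X j (\<lambda>s. \<Sum>i \<in> I. z i s)"
  unfolding chain_on_def
proof (intro allI impI)
  fix s assume "(\<Sum>i \<in> I. z i s) \<noteq> 0"
  then obtain i where "i \<in> I" "z i s \<noteq> 0" by (meson sum.neutral)
  then show "s \<in> X \<and> card s = j" using assms chain_onD by blast
qed

section \<open>The topological Hall theorem by a Sperner count\<close>

definition colour_restrict :: "('v \<Rightarrow> 'c) \<Rightarrow> 'v set \<Rightarrow> 'c set \<Rightarrow> 'v set" where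
  "colour_restrict col V I = {v \<in> V. col v \<in> I}"

text \<open>These chains behave like the image of a full simplex with vertex set \<open>A\<close> under a chain map, so
  that a Sperner parity count applies to them.\<close>

lemma coloured_chains_exist:
  assumes finA: "finite A"
    and acyc: "\<And>I. I \<subseteq> A \<Longrightarrow> acyclic_upto U (card I) (indep_sets (colour_restrict col V I) E)"
  shows "\<exists>c. c {} = (\<lambda>s. of_bool (s = {})) \<and>
    (\<forall>I \<subseteq> A. chain_on (indep_sets (colour_restrict col V I) E) (card I) (c I) \<and>
       boundary U (c I) = (\<lambda>s. \<Sum>i \<in> I. c (I - {i}) s))"
proof -
  let ?X = "\<lambda>I. indep_sets (colour_restrict col V I) E"
  let ?good = "\<lambda>c I. chain_on (?X I) (card I) (c I) \<and> boundary U (c I) = (\<lambda>s. \<Sum>i \<in> I. c (I - {i}) s)"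
  have "\<exists>c. c {} = (\<lambda>s. of_bool (s = {})) \<and> (\<forall>I \<subseteq> A. card I \<le> n \<longrightarrow> ?good c I)" for n
  proof (induction n)
    case 0
    show ?case
    proof (intro exI conjI allI impI)
      fix I assume "I \<subseteq> A" "card I \<le> 0"
      then have [simp]: "I = {}" using finA by (metis card_0_eq finite_subset le_zero_eq)
      show "chain_on (?X I) (card I) ((\<lambda>_ s. of_bool (s = {})) I)"
        by (auto simp: chain_on_def indep_sets_def)
      show "boundary U ((\<lambda>_ s. of_bool (s = {})) I) = (\<lambda>s. \<Sum>i \<in> I. (\<lambda>_ s. of_bool (s = {})) (I - {i}) s)"
        by (simp add: boundary_def fun_eq_iff)
    qed simp
  next
    case (Suc n)
    then obtain c where c0: "c {} = (\<lambda>s. of_bool (s = {}))"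
      and c: "\<And>I. I \<subseteq> A \<Longrightarrow> card I \<le> n \<Longrightarrow> ?good c I" by blast
    \<comment> \<open>The chains of the facets of \<open>I\<close> add up to a cycle of degree
      \<open>n\<close>, since each face of codimension two occurs twice. As
      \<open>n < card I\<close>, acyclicity fills it.\<close>
    have ex: "\<exists>w. chain_on (?X I) (Suc n) w \<and> boundary U w = (\<lambda>s. \<Sum>i \<in> I. c (I - {i}) s)"
      if I: "I \<subseteq> A" "card I = Suc n" for I
    proof -
      have finI: "finite I" using I finA finite_subset by blast
      have cI: "card (I - {i}) = n" if "i \<in> I" for i using that I finI by simp
      have "chain_on (?X I) n (\<lambda>s. \<Sum>i \<in> I. c (I - {i}) s)"
      proof (rule chain_on_sum)
        fix i assume i: "i \<in> I"
        then have "chain_on (?X (I - {i})) n (c (I - {i}))" using c[of "I - {i}"] cI I by auto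
        moreover have "?X (I - {i}) \<subseteq> ?X I" by (auto simp: indep_sets_def colour_restrict_def)
        ultimately show "chain_on (?X I) n (c (I - {i}))" by (auto simp: chain_on_def)
      qed
      moreover have "boundary U (\<lambda>s. \<Sum>i \<in> I. c (I - {i}) s) = (\<lambda>_. 0)"
      proof
        fix s
        have "boundary U (\<lambda>s. \<Sum>i \<in> I. c (I - {i}) s) s = (\<Sum>i \<in> I. \<Sum>j \<in> I - {i}. c (I - {i} - {j}) s)"
        proof (subst boundary_sum, rule sum.cong)
          fix i assume i: "i \<in> I"
          then have "boundary U (c (I - {i})) = (\<lambda>s. \<Sum>j \<in> I - {i}. c (I - {i} - {j}) s)"
            using c[of "I - {i}"] cI I by auto
          then show "boundary U (c (I - {i})) s = (\<Sum>j \<in> I - {i}. c (I - {i} - {j}) s)" by simp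
        qed simp
        also have "\<dots> = 0" by (rule sum_symmetric_pairs_bit[OF finI]) (simp add: Diff_insert2[symmetric] insert_commute)
        finally show "boundary U (\<lambda>s. \<Sum>i \<in> I. c (I - {i}) s) s = 0" .
      qed
      ultimately show ?thesis
        using acyc[OF I(1), unfolded acyclic_upto_def I(2), rule_format, OF lessI] by simp
    qed
    define c' where "c' I = (if card I = Suc n then
      (SOME w. chain_on (?X I) (Suc n) w \<and> boundary U w = (\<lambda>s. \<Sum>i \<in> I. c (I - {i}) s)) else c I)" for I
    have "?good c' I" if I: "I \<subseteq> A" "card I \<le> Suc n" for I
    proof -
      have finI: "finite I" using I finA finite_subset by blast
      have low: "c' (I - {i}) = c (I - {i})" if "i \<in> I" for i
      proof -
        have "card (I - {i}) < card I" using that finI by (rule card_Diff1_less[rotated])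
        then show ?thesis using I by (simp add: c'_def)
      qed
      then have sm: "(\<Sum>i \<in> I. c' (I - {i}) s) = (\<Sum>i \<in> I. c (I - {i}) s)" for s by simp
      show ?thesis
      proof (cases "card I = Suc n")
        case True
        then show ?thesis using someI_ex[OF ex[OF I(1) True]] unfolding sm by (simp add: c'_def)
      next
        case False
        then show ?thesis using c[of I] I unfolding sm by (simp add: c'_def)
      qed
    qed
    moreover have "c' {} = (\<lambda>s. of_bool (s = {}))" using c0 by (simp add: c'_def)
    ultimately show ?case by blast
  qed
  from this[of "card A"] obtain c where "c {} = (\<lambda>s. of_bool (s = {}))"
    and "\<forall>I \<subseteq> A. card I \<le> card A \<longrightarrow> ?good c I" by blast
  then show ?thesis using card_mono[OF finA] by (intro exI[of _ c]) simp
qed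

text \<open>The chain attached to \<open>I\<close> contains an odd number of simplices with each
  colour of \<open>I\<close> exactly once. This follows by induction on \<open>I\<close> from
  counting pairs of a simplex and a facet that is rainbow for one colour fewer; for
  \<open>I = A\<close> an odd number is not zero.\<close>

theorem rainbow_independent_set:
  assumes finA: "finite A" and fin: "finite U" and VU: "V \<subseteq> U"
    and acyc: "\<And>I. I \<subseteq> A \<Longrightarrow> acyclic_upto U (card I) (indep_sets (colour_restrict col V I) E)"
  shows "\<exists>s \<in> indep_sets V E. col ` s = A \<and> card s = card A"
proof -
  let ?X = "\<lambda>I. indep_sets (colour_restrict col V I) E"
  obtain c where c0: "c {} = (\<lambda>s. of_bool (s = {}))"
    and c: "\<And>I. I \<subseteq> A \<Longrightarrow> chain_on (?X I) (card I) (c I)"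
      "\<And>I. I \<subseteq> A \<Longrightarrow> boundary U (c I) = (\<lambda>s. \<Sum>i \<in> I. c (I - {i}) s)"
    using coloured_chains_exist[OF finA acyc] by blast
  define R where "R I = {s \<in> Pow U. col ` s = I \<and> card s = card I}" for I
  have finR: "finite (R I)" for I using fin by (simp add: R_def)
  have odd: "(\<Sum>s \<in> R I. c I s) = 1" if "finite I" "I \<subseteq> A" for I
    using that
  proof (induction I)
    case empty
    have "R {} = {{}}" by (auto simp: R_def)
    then show ?case by (simp add: c0)
  next
    case (insert i J)
    let ?I = "insert i J"
    let ?N = "\<lambda>s. {v \<in> s. s - {v} \<in> R J}"
    have supp: "col ` s \<subseteq> ?I \<and> card s = card ?I \<and> finite s" if "c ?I s \<noteq> 0" for s
    proof -
      from chain_onD[OF c(1)[OF insert.prems] that]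
      show ?thesis using finite_subset[OF _ fin] VU by (auto simp: indep_sets_def colour_restrict_def)
    qed
    have "1 = (\<Sum>t \<in> R J. c J t)" using insert by simp
    also have "\<dots> = (\<Sum>t \<in> R J. boundary U (c ?I) t)"
    proof (rule sum.cong)
      fix t assume t: "t \<in> R J"
      \<comment> \<open>A simplex in the support of this chain has no vertex of colour
        \<open>j\<close>, whereas \<open>t\<close> has one; only the facet \<open>J\<close>
        contributes at \<open>t\<close>.\<close>
      have "c (?I - {j}) t = 0" if "j \<in> J" for j
      proof -
        have "?I - {j} \<subseteq> A" using insert.prems by auto
        moreover have "t \<notin> ?X (?I - {j})" using t that
          by (auto simp: R_def indep_sets_def colour_restrict_def)
        ultimately show ?thesis by (intro chain_on_eq_0[OF c(1)])
      qed
      then have "boundary U (c ?I) t = c (?I - {i}) t"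
        using c(2)[OF insert.prems] insert.hyps by simp
      also have "?I - {i} = J" using insert.hyps by auto
      finally show "c J t = boundary U (c ?I) t" by simp
    qed simp
    \<comment> \<open>Pairs of a facet and an added vertex are regrouped by the enlarged
      simplex.\<close>
    also have "\<dots> = (\<Sum>(t, v) \<in> Sigma (R J) (\<lambda>t. U - t). c ?I (insert v t))"
      unfolding boundary_def using fin finR by (subst sum.Sigma) auto
    also have "\<dots> = (\<Sum>(s, v) \<in> Sigma (Pow U) ?N. c ?I s)"
    proof (rule sum.reindex_bij_witness[where i = "\<lambda>(s, v). (s - {v}, v)" and j = "\<lambda>(t, v). (insert v t, v)"])
      fix a assume "a \<in> Sigma (R J) (\<lambda>t. U - t)"
      then obtain t v where a: "a = (t, v)" "t \<in> R J" "v \<in> U" "v \<notin> t" by auto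
      then have "insert v t - {v} = t" "t \<subseteq> U" by (auto simp: R_def)
      then show "(case case a of (t, v) \<Rightarrow> (insert v t, v) of (s, v) \<Rightarrow> (s - {v}, v)) = a"
        "(case a of (t, v) \<Rightarrow> (insert v t, v)) \<in> Sigma (Pow U) ?N"
        "(case case a of (t, v) \<Rightarrow> (insert v t, v) of (s, v) \<Rightarrow> c ?I s) = (case a of (t, v) \<Rightarrow> c ?I (insert v t))"
        using a by simp_all
    next
      fix b assume "b \<in> Sigma (Pow U) ?N"
      then obtain s v where b: "b = (s, v)" "s \<subseteq> U" "v \<in> s" "s - {v} \<in> R J" by auto
      then have "insert v (s - {v}) = s" by auto
      then show "(case case b of (s, v) \<Rightarrow> (s - {v}, v) of (t, v) \<Rightarrow> (insert v t, v)) = b"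
        "(case b of (s, v) \<Rightarrow> (s - {v}, v)) \<in> Sigma (R J) (\<lambda>t. U - t)"
        using b by auto
    qed
    also have "\<dots> = (\<Sum>s \<in> Pow U. \<Sum>v \<in> ?N s. c ?I s)"
      using fin by (subst sum.Sigma) (auto intro: finite_subset)
    also have "\<dots> = (\<Sum>s \<in> Pow U. of_nat (card (?N s)) * c ?I s)" by simp
    \<comment> \<open>For \<open>s\<close> in the support, \<open>?N s\<close> is a singleton if
      \<open>s\<close> is rainbow for \<open>?I\<close>. Otherwise it is empty, or \<open>s\<close>
      has exactly the colours \<open>J\<close> and \<open>?N s\<close> consists of the two vertices
      sharing a colour; both cases vanish modulo 2.\<close>
    also have "\<dots> = (\<Sum>s \<in> R ?I. c ?I s)"
    proof -
      have "of_nat (card (?N s)) * c ?I s = (if s \<in> R ?I then c ?I s else 0)" if s: "s \<in> Pow U" for s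
      proof (cases "c ?I s = 0")
        case False
        note sp = supp[OF False]
        have fs: "finite s" using sp by simp
        have cs: "card s = Suc (card J)" using sp insert.hyps by simp
        have Niff: "v \<in> ?N s \<longleftrightarrow> v \<in> s \<and> col ` (s - {v}) = J" for v
          using s fs cs by (auto simp: R_def)
        show ?thesis
        proof (cases "col ` s = ?I")
          case True
          then have inj: "inj_on col s" using sp fs by (metis eq_card_imp_inj_on)
          have "i \<in> col ` s" using True by simp
          then obtain v where v: "v \<in> s" "col v = i" by (rule imageE) simp
          have "col ` (s - {u}) = ?I - {col u}" if "u \<in> s" for u
            using inj_on_image_set_diff[OF inj, of s "{u}"] that True by simp
          then have "u \<in> ?N s \<longleftrightarrow> u \<in> s \<and> col u = i" for u
            unfolding Niff using insert.hyps by auto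
          moreover have "u = v" if "u \<in> s" "col u = i" for u
            using inj_onD[OF inj] that v by simp
          ultimately have "?N s = {v}" using v by blast
          then show ?thesis using True s sp by (simp add: R_def)
        next
          case nI: False
          have "even (card (?N s))"
          proof (cases "col ` s = J")
            case True
            have "\<not> inj_on col s" using True cs by (metis card_image n_not_Suc_n)
            then obtain x y where xy: "x \<in> s" "y \<in> s" "x \<noteq> y" "col x = col y"
              by (auto simp: inj_on_def)
            have inN: "u \<in> ?N s" if "u \<in> s" "u' \<in> s" "u \<noteq> u'" "col u = col u'" for u u'
              unfolding Niff using that True by (auto simp: image_iff)
            have "u = x \<or> u = y" if u: "u \<in> ?N s" for u
            proof (rule ccontr)
              assume n: "\<not> (u = x \<or> u = y)"
              have "card (s - {u}) = card (col ` (s - {u}))" using u Niff fs cs by simp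
              then have "inj_on col (s - {u})" using fs by (simp add: eq_card_imp_inj_on)
              then show False using xy n by (auto simp: inj_on_def)
            qed
            then have "?N s = {x, y}" using inN[of x y] inN[of y x] xy by auto
            then show ?thesis using xy by simp
          next
            case nJ: False
            have "v \<notin> ?N s" for v
            proof
              assume "v \<in> ?N s"
              then have "J \<subseteq> col ` s" unfolding Niff by auto
              then show False using sp nI nJ by auto
            qed
            then have "?N s = {}" by blast
            then show ?thesis by (simp only: card.empty even_zero)
          qed
          then have "of_nat (card (?N s)) = (0 :: bit)" by (elim evenE) simp
          then show ?thesis using nI by (simp add: R_def)
        qed
      qed simp
      then have "(\<Sum>s \<in> Pow U. of_nat (card (?N s)) * c ?I s) = (\<Sum>s \<in> Pow U. if s \<in> R ?I then c ?I s else 0)"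
        by (intro sum.cong) auto
      also have "\<dots> = (\<Sum>s \<in> R ?I. c ?I s)" using fin by (subst sum.inter_restrict[symmetric]) (auto simp: R_def intro!: sum.cong)
      finally show ?thesis .
    qed
    finally show ?case by simp
  qed
  have "(\<Sum>s \<in> R A. c A s) \<noteq> 0" using odd[OF finA] by simp
  then obtain s where s: "s \<in> R A" "c A s \<noteq> 0" by (meson sum.neutral)
  have "s \<in> ?X A" using chain_onD(1)[OF c(1)[OF subset_refl] s(2)] .
  then have "s \<in> indep_sets V E" by (auto simp: indep_sets_def colour_restrict_def)
  then show ?thesis using s(1) by (auto simp: R_def)
qed

section \<open>Line graphs of weighted bipartite graphs\<close>

lemma sum_Un_nat_le:
  fixes w :: "'v \<Rightarrow> nat"
  assumes "finite A" "finite B"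
  shows "sum w (A \<union> B) \<le> sum w A + sum w B"
  using sum.union_inter[OF assms, of w] by linarith

text \<open>The deletion-explosion game. Pairs are offered in the order: two vertices of positive weight
  sharing \<open>\<beta>\<close>, then any two vertices of positive weight, then any pair meeting the support;
  with this order every explosion destroys weight at most \<open>k + 2\<close>.\<close>

lemma acyclic_upto_line_graph:
  fixes w :: "'v \<Rightarrow> nat" and \<beta> :: "'v \<Rightarrow> 'b" and \<gamma> :: "'v \<Rightarrow> 'c"
  assumes fin: "finite U" and VU: "V \<subseteq> U" and symE: "sym E" and irr: "irrefl E"
    and line: "\<And>x y. x \<in> V \<Longrightarrow> y \<in> V \<Longrightarrow> (x, y) \<in> E \<Longrightarrow> \<beta> x = \<beta> y \<or> \<gamma> x = \<gamma> y"
    and degB: "\<And>b. sum w {x \<in> V. \<beta> x = b} \<le> k"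
    and degC: "\<And>c. sum w {x \<in> V. \<gamma> x = c} \<le> 2"
    and tot: "(k + 2) * m < sum w V + (k + 2)"
  shows "acyclic_upto U m (indep_sets V E)"
  using VU symE irr line degB degC tot
\<comment> \<open>Deletion and explosion both lower the number of related pairs inside
  \<open>V\<close>.\<close>
proof (induction "card (E \<inter> V \<times> V)" arbitrary: V E m rule: less_induct)
  case less
  note VU = less.prems(1) and symE = less.prems(2) and irr = less.prems(3) and line = less.prems(4)
    and degB = less.prems(5) and degC = less.prems(6) and tot = less.prems(7)
  have finV: "finite V" using VU fin finite_subset by blast
  show ?case
  proof (cases "m = 0")
    case True
    then show ?thesis by (simp add: acyclic_upto_def)
  next
    case m: False
    consider (isolated) x where "x \<in> V" "\<And>y. y \<in> V \<Longrightarrow> (x, y) \<notin> E"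
      | (pair) x y where "x \<in> V" "y \<in> V" "(x, y) \<in> E"
          "sum w {z \<in> V. (x, z) \<in> E \<or> (y, z) \<in> E} \<le> k + 2"
    proof -
      have killed: "sum w {z \<in> V. (x, z) \<in> E \<or> (y, z) \<in> E} \<le> sum w S"
        if "S \<subseteq> V" "\<And>z. z \<in> V \<Longrightarrow> w z > 0 \<Longrightarrow> (x, z) \<in> E \<or> (y, z) \<in> E \<Longrightarrow> z \<in> S" for x y S
      proof -
        have "sum w {z \<in> V. (x, z) \<in> E \<or> (y, z) \<in> E} = sum w {z \<in> V. ((x, z) \<in> E \<or> (y, z) \<in> E) \<and> w z > 0}"
          using finV by (intro sum.mono_neutral_right) auto
        also have "\<dots> \<le> sum w S"
          using that finV by (intro sum_mono2) (auto intro: finite_subset)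
        finally show ?thesis .
      qed
      have "sum w V > 0"
      proof -
        have "k + 2 \<le> (k + 2) * m" using m by (cases m) auto
        from le_less_trans[OF this tot] show ?thesis by simp
      qed
      then obtain x where x: "x \<in> V" "w x > 0"
        by (metis (no_types, lifting) gr0I less_irrefl sum.neutral)
      show thesis
      proof (cases "\<exists>x \<in> V. \<exists>y \<in> V. w x > 0 \<and> w y > 0 \<and> (x, y) \<in> E \<and> \<beta> x = \<beta> y")
        case True
        then obtain x y where xy: "x \<in> V" "y \<in> V" "w x > 0" "w y > 0" "(x, y) \<in> E" "\<beta> x = \<beta> y" by blast
        let ?B = "{z \<in> V. \<beta> z = \<beta> x}" and ?C = "\<lambda>u. {z \<in> V. \<gamma> z = \<gamma> u}"
        \<comment> \<open>Since \<open>w u\<close> is at least \<open>1\<close> and the capacity is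
          \<open>2\<close>, at most one further unit sits at the \<gamma>-end of \<open>u\<close>.
          Both \<open>x\<close> and \<open>y\<close> are counted in \<open>?B\<close>, which gives
          \<open>k + 1 + 1\<close> below.\<close>
        have C1: "sum w (?C u - {u}) \<le> 1" if "u \<in> V" "w u > 0" for u
        proof -
          have "sum w (?C u) = w u + sum w (?C u - {u})"
            using that finV by (intro sum.remove) auto
          then show ?thesis using degC[of "\<gamma> u"] that by linarith
        qed
        have "sum w {z \<in> V. (x, z) \<in> E \<or> (y, z) \<in> E} \<le> sum w (?B \<union> ((?C x - {x}) \<union> (?C y - {y})))"
          by (rule killed) (use line[OF xy(1)] line[OF xy(2)] xy in \<open>auto\<close>, metis+)
        also have "\<dots> \<le> sum w ?B + (sum w (?C x - {x}) + sum w (?C y - {y}))"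
          using finV by (intro order_trans[OF sum_Un_nat_le add_left_mono[OF sum_Un_nat_le]]) auto
        also have "\<dots> \<le> k + 2" using degB[of "\<beta> x"] C1[of x] C1[of y] xy by linarith
        finally show thesis using that(2) xy by blast
      next
        case noB: False
        show thesis
        proof (cases "\<exists>x \<in> V. \<exists>y \<in> V. w x > 0 \<and> w y > 0 \<and> (x, y) \<in> E")
          case True
          then obtain x y where xy: "x \<in> V" "y \<in> V" "w x > 0" "w y > 0" "(x, y) \<in> E" by blast
          \<comment> \<open>With the first kind of pair excluded, adjacent vertices of positive
            weight agree under \<gamma>, so all weight destroyed sits at a single
            \<gamma>-end.\<close>
          have g: "\<gamma> u = \<gamma> v" if "u \<in> V" "v \<in> V" "w u > 0" "w v > 0" "(u, v) \<in> E" for u v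
            using noB line that by blast
          have "sum w {z \<in> V. (x, z) \<in> E \<or> (y, z) \<in> E} \<le> sum w {z \<in> V. \<gamma> z = \<gamma> x}"
            by (rule killed) (use g xy in \<open>auto\<close>, metis+)
          then show thesis using that(2)[of x y] xy degC[of "\<gamma> x"] by linarith
        next
          case noS: False
          show thesis
          proof (cases "\<exists>y \<in> V. (x, y) \<in> E")
            case True
            then obtain y where y: "y \<in> V" "(x, y) \<in> E" by blast
            \<comment> \<open>Positive weights are now pairwise non-adjacent, so the neighbours of
              \<open>x\<close> have weight \<open>0\<close> and only those of \<open>y\<close>
              count.\<close>
            have "sum w {z \<in> V. (x, z) \<in> E \<or> (y, z) \<in> E} \<le> sum w ({z \<in> V. \<beta> z = \<beta> y} \<union> {z \<in> V. \<gamma> z = \<gamma> y})"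
            proof (rule killed)
              fix z assume z: "z \<in> V" "w z > 0" "(x, z) \<in> E \<or> (y, z) \<in> E"
              then have "(y, z) \<in> E" using noS x by blast
              then show "z \<in> {z \<in> V. \<beta> z = \<beta> y} \<union> {z \<in> V. \<gamma> z = \<gamma> y}"
                using line[OF y(1) z(1)] z by auto
            qed auto
            also have "\<dots> \<le> sum w {z \<in> V. \<beta> z = \<beta> y} + sum w {z \<in> V. \<gamma> z = \<gamma> y}"
              using finV by (intro sum_Un_nat_le) auto
            also have "\<dots> \<le> k + 2" using degB[of "\<beta> y"] degC[of "\<gamma> y"] by linarith
            finally show thesis using that(2) x y by blast
          next
            case False
            then show thesis using that(1) x by blast
          qed
        qed
      qed
    qed
    then show ?thesis
    proof cases
      case isolated
      then show ?thesis using acyclic_upto_isolated[OF fin VU] symE by (meson symD)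
    next
      case (pair x y)
      have yx: "(y, x) \<in> E" using pair symE by (auto dest: symD)
      let ?K = "{z \<in> V. (x, z) \<in> E \<or> (y, z) \<in> E}" and ?V = "{z \<in> V. (x, z) \<notin> E \<and> (y, z) \<notin> E}"
      let ?E = "E - {(x, y), (y, x)}"
      have finE: "finite (E \<inter> V \<times> V)" using finV by blast
      have "acyclic_upto U m (indep_sets V ?E)"
      proof (rule less.hyps)
        show "card (?E \<inter> V \<times> V) < card (E \<inter> V \<times> V)"
          using pair by (intro psubset_card_mono finE) auto
      qed (use VU symE irr line degB degC tot in \<open>auto simp: sym_def irrefl_def\<close>)
      moreover have "acyclic_upto U (m - 1) (indep_sets ?V E)"
      proof (rule less.hyps)
        show "card (E \<inter> ?V \<times> ?V) < card (E \<inter> V \<times> V)"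
          using pair yx by (intro psubset_card_mono finE) blast
        have le: "sum w {x \<in> ?V. P x} \<le> sum w {x \<in> V. P x}" for P
          using finV by (intro sum_mono2) auto
        show "sum w {x \<in> ?V. \<beta> x = b} \<le> k" for b by (rule order_trans[OF le degB])
        show "sum w {x \<in> ?V. \<gamma> x = c} \<le> 2" for c by (rule order_trans[OF le degC])
        \<comment> \<open>The loss of at most \<open>k + 2\<close> is paid for by lowering
          \<open>m\<close> by one.\<close>
        have "sum w (?V \<union> ?K) = sum w ?V + sum w ?K"
          using finV by (intro sum.union_disjoint) auto
        moreover have "?V \<union> ?K = V" by auto
        ultimately have "sum w V = sum w ?V + sum w ?K" by simp
        moreover have "(k + 2) * m = (k + 2) * (m - 1) + (k + 2)" using m by (cases m) auto
        ultimately show "(k + 2) * (m - 1) < sum w ?V + (k + 2)" using tot pair(4) by linarith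
      qed (use VU symE irr line in \<open>auto simp: sym_def irrefl_def\<close>)
      ultimately show ?thesis by (rule acyclic_upto_explode[OF fin VU pair(1-3) symE irr])
    qed
  qed
qed

section \<open>Integral weights from a capacitated Hall theorem\<close>

text \<open>Rado's argument for Hall's theorem: in an edge-minimal graph satisfying the deficiency condition,
  two edges with a common \<open>\<gamma>\<close>-end yield two tight sets violating submodularity.\<close>

lemma capacitated_hall:
  fixes \<beta> :: "'e \<Rightarrow> 'b" and \<gamma> :: "'e \<Rightarrow> 'c"
  assumes fin: "finite E"
    and hall: "\<And>X. X \<subseteq> \<beta> ` E \<Longrightarrow> M \<le> k * card (\<beta> ` E - X) + card (\<gamma> ` {e \<in> E. \<beta> e \<in> X})"
  shows "\<exists>G \<subseteq> E. inj_on \<gamma> G \<and> (\<forall>b. card {e \<in> G. \<beta> e = b} \<le> k) \<and> M \<le> card G"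
proof -
  define B where "B = \<beta> ` E"
  define N where "N F X = \<gamma> ` {e \<in> F. \<beta> e \<in> X}" for F X
  define good where "good F \<longleftrightarrow> F \<subseteq> E \<and> (\<forall>X \<subseteq> B. M \<le> k * card (B - X) + card (N F X))" for F
  have finB: "finite B" using fin by (simp add: B_def)
  have "good E" using hall by (simp add: good_def B_def N_def)
  then obtain F where F: "good F" and minF: "\<And>F'. good F' \<Longrightarrow> card F \<le> card F'"
    using arg_min_nat_lemma[of good E card] by blast
  have FE: "F \<subseteq> E" using F by (simp add: good_def)
  have finF: "finite F" using FE fin finite_subset by blast
  have finN: "finite (N F' X)" if "F' \<subseteq> F" for F' X
    using finite_subset[OF that finF] by (simp add: N_def)
  have inj: "inj_on \<gamma> F"
  proof (rule ccontr)
    assume "\<not> inj_on \<gamma> F"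
    then obtain e1 e2 where e: "e1 \<in> F" "e2 \<in> F" "e1 \<noteq> e2" "\<gamma> e1 = \<gamma> e2" by (auto simp: inj_on_def)
    \<comment> \<open>By minimality, removing \<open>a\<close> violates the condition at some
      \<open>X\<close>. The neighbourhood of \<open>X\<close> must shrink, so \<open>a\<close> is
      the only edge from \<open>X\<close> to its \<gamma>-end.\<close>
    have tight: "\<exists>X \<subseteq> B. k * card (B - X) + card (N (F - {a}) X) < M \<and> \<beta> a \<in> X \<and> \<gamma> a \<notin> N (F - {a}) X"
      if a: "a \<in> F" for a
    proof -
      have "card (F - {a}) < card F" using a finF by (simp only: card_Diff1_less)
      then have "\<not> good (F - {a})" using minF[of "F - {a}"] by linarith
      then obtain X where X: "X \<subseteq> B" "k * card (B - X) + card (N (F - {a}) X) < M"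
        using FE by (auto simp: good_def not_le)
      have ne: "card (N (F - {a}) X) < card (N F X)"
        using X(2) F[unfolded good_def, THEN conjunct2, rule_format, OF X(1)] by linarith
      then have "N F X \<noteq> N (F - {a}) X" by auto
      then have "\<beta> a \<in> X" "\<gamma> a \<notin> N (F - {a}) X" by (auto simp: N_def)
      then show ?thesis using X by blast
    qed
    obtain X1 where X1: "X1 \<subseteq> B" "k * card (B - X1) + card (N (F - {e1}) X1) < M" "\<beta> e1 \<in> X1"
      "\<gamma> e1 \<notin> N (F - {e1}) X1" using tight[OF e(1)] by blast
    obtain X2 where X2: "X2 \<subseteq> B" "k * card (B - X2) + card (N (F - {e2}) X2) < M" "\<beta> e2 \<in> X2"
      "\<gamma> e2 \<notin> N (F - {e2}) X2" using tight[OF e(2)] by blast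
    let ?N1 = "N (F - {e1}) X1" and ?N2 = "N (F - {e2}) X2"
    have off: "\<beta> e2 \<notin> X1" "\<beta> e1 \<notin> X2" using X1(4) X2(4) e by (force simp: N_def image_iff)+
    \<comment> \<open>Restoring \<open>e1\<close> and \<open>e2\<close> adds only their common
      \<gamma>-end.\<close>
    have "N F (X1 \<union> X2) \<subseteq> insert (\<gamma> e1) (?N1 \<union> ?N2)" using e by (auto simp: N_def)
    then have "card (N F (X1 \<union> X2)) \<le> card (insert (\<gamma> e1) (?N1 \<union> ?N2))"
      using finN by (intro card_mono) auto
    also have "\<dots> \<le> Suc (card (?N1 \<union> ?N2))" by (rule card_insert_le_m1) auto
    finally have u: "card (N F (X1 \<union> X2)) \<le> Suc (card (?N1 \<union> ?N2))" .
    have "N F (X1 \<inter> X2) \<subseteq> ?N1 \<inter> ?N2" using off by (auto simp: N_def)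
    then have i: "card (N F (X1 \<inter> X2)) \<le> card (?N1 \<inter> ?N2)"
      using finN by (intro card_mono) auto
    have n: "card ?N1 + card ?N2 = card (?N1 \<union> ?N2) + card (?N1 \<inter> ?N2)"
      using finN by (intro card_Un_Int) auto
    have "card (B - X1) + card (B - X2) = card ((B - X1) \<union> (B - X2)) + card ((B - X1) \<inter> (B - X2))"
      using finB by (intro card_Un_Int) auto
    also have "(B - X1) \<union> (B - X2) = B - X1 \<inter> X2" by auto
    also have "(B - X1) \<inter> (B - X2) = B - (X1 \<union> X2)" by auto
    finally have "k * card (B - X1) + k * card (B - X2) = k * card (B - X1 \<inter> X2) + k * card (B - (X1 \<union> X2))"
      by (metis add_mult_distrib2)
    moreover have "M \<le> k * card (B - (X1 \<union> X2)) + card (N F (X1 \<union> X2))"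
      "M \<le> k * card (B - X1 \<inter> X2) + card (N F (X1 \<inter> X2))"
      using F X1(1) X2(1) unfolding good_def by (simp, blast)
    \<comment> \<open>The two violated conditions sum to at most \<open>2 * M - 2\<close>, but the
      conditions for union and intersection, with one extra element, force at least
      \<open>2 * M - 1\<close>.\<close>
    ultimately show False using u i n X1(2) X2(2) by linarith
  qed
  \<comment> \<open>As \<gamma> is injective on \<open>F\<close>, the star of each \<beta>-end can
    be trimmed to \<open>k\<close> edges independently.\<close>
  define D where "D b = {e \<in> F. \<beta> e = b}" for b
  have "\<exists>S \<subseteq> D b. card S = min k (card (D b))" for b
    by (metis min.cobounded2 obtain_subset_with_card_n)
  then obtain S where S: "\<And>b. S b \<subseteq> D b" "\<And>b. card (S b) = min k (card (D b))" by metis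
  have finD: "finite (D b)" for b using finF by (simp add: D_def)
  have finS: "finite (S b)" for b using finite_subset[OF S(1) finD] .
  let ?G = "\<Union>b \<in> B. S b"
  have SD: "e \<in> F \<and> \<beta> e = b" if "e \<in> S b" for e b using S(1)[of b] that by (auto simp: D_def)
  have GF: "?G \<subseteq> F" using SD by blast
  have "card {e \<in> ?G. \<beta> e = b} \<le> k" for b
  proof -
    have "{e \<in> ?G. \<beta> e = b} \<subseteq> S b" using SD by auto
    then have "card {e \<in> ?G. \<beta> e = b} \<le> card (S b)" by (rule card_mono[OF finS])
    then show ?thesis using S(2)[of b] by simp
  qed
  moreover have "M \<le> card ?G"
  proof -
    \<comment> \<open>For this set the right side of the deficiency condition is exactly the number
      of edges kept.\<close>
    let ?X = "{b \<in> B. card (D b) \<le> k}"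
    have "N F ?X = \<gamma> ` (\<Union>b \<in> ?X. D b)" by (auto simp: N_def D_def)
    moreover have "inj_on \<gamma> (\<Union>b \<in> ?X. D b)" by (rule inj_on_subset[OF inj]) (auto simp: D_def)
    ultimately have "card (N F ?X) = card (\<Union>b \<in> ?X. D b)" by (simp add: card_image)
    also have "\<dots> = (\<Sum>b \<in> ?X. card (D b))"
      using finB finD by (intro card_UN_disjoint) (auto simp: D_def)
    also have "\<dots> = (\<Sum>b \<in> ?X. min k (card (D b)))" by (intro sum.cong) auto
    finally have c1: "card (N F ?X) = (\<Sum>b \<in> ?X. min k (card (D b)))" .
    have c2: "k * card (B - ?X) = (\<Sum>b \<in> B - ?X. min k (card (D b)))"
    proof -
      have "(\<Sum>b \<in> B - ?X. min k (card (D b))) = (\<Sum>b \<in> B - ?X. k)" by (rule sum.cong) auto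
      then show ?thesis by simp
    qed
    have "M \<le> k * card (B - ?X) + card (N F ?X)"
      using F[unfolded good_def, THEN conjunct2, rule_format, of ?X] by auto
    also have "\<dots> = (\<Sum>b \<in> B. min k (card (D b)))"
      unfolding c1 c2 by (rule sum.subset_diff[symmetric]) (use finB in auto)
    also have "\<dots> = (\<Sum>b \<in> B. card (S b))" by (simp add: S(2))
    also have "\<dots> = card ?G" using finB finS SD by (intro card_UN_disjoint[symmetric]) (simp, simp, blast)
    finally show ?thesis .
  qed
  ultimately show ?thesis using GF FE inj_on_subset[OF inj GF] by (intro exI[of _ ?G]) auto
qed

text \<open>Every \<gamma>-end is split into two copies, turning capacity \<open>2\<close> into
  injectivity, and \<open>w\<close> counts the chosen copies of an edge. The fractional weights
  certify the deficiency condition: edges with \<beta>-end in \<open>X\<close> weigh at most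
  \<open>2\<close> per \<gamma>-end, the others at most \<open>k\<close> per \<beta>-end.\<close>

lemma integral_edge_weights:
  fixes g :: "'e \<Rightarrow> real" and \<beta> :: "'e \<Rightarrow> 'b" and \<gamma> :: "'e \<Rightarrow> 'c"
  assumes fin: "finite E" and nonneg: "\<And>e. e \<in> E \<Longrightarrow> g e \<ge> 0"
    and degB: "\<And>b. sum g {e \<in> E. \<beta> e = b} \<le> real k"
    and degC: "\<And>c. sum g {e \<in> E. \<gamma> e = c} \<le> 2"
  shows "\<exists>w :: 'e \<Rightarrow> nat. (\<forall>b. sum w {e \<in> E. \<beta> e = b} \<le> k) \<and>
    (\<forall>c. sum w {e \<in> E. \<gamma> e = c} \<le> 2) \<and> sum g E \<le> real (sum w E)"
proof -
  let ?E = "E \<times> (UNIV :: bool set)"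
  let ?\<beta> = "\<lambda>x :: 'e \<times> bool. \<beta> (fst x)" and ?\<gamma> = "\<lambda>x :: 'e \<times> bool. (\<gamma> (fst x), snd x)"
  have B: "?\<beta> ` ?E = \<beta> ` E" by force
  have finE: "finite ?E" using fin by simp
  have hall: "nat \<lceil>sum g E\<rceil> \<le> k * card (?\<beta> ` ?E - X) + card (?\<gamma> ` {x \<in> ?E. ?\<beta> x \<in> X})"
    if "X \<subseteq> ?\<beta> ` ?E" for X
  proof -
    have "?\<gamma> ` {x \<in> ?E. ?\<beta> x \<in> X} = (\<gamma> ` {e \<in> E. \<beta> e \<in> X}) \<times> UNIV" by force
    then have card\<gamma>: "card (?\<gamma> ` {x \<in> ?E. ?\<beta> x \<in> X}) = 2 * card (\<gamma> ` {e \<in> E. \<beta> e \<in> X})"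
      by (simp add: card_cartesian_product)
    let ?P = "{e \<in> E. \<beta> e \<in> X}" and ?Q = "{e \<in> E. \<beta> e \<notin> X}"
    have "sum g (?P \<union> ?Q) = sum g ?P + sum g ?Q" using fin by (intro sum.union_disjoint) auto
    moreover have "?P \<union> ?Q = E" by auto
    moreover have "sum g ?P \<le> (\<Sum>c \<in> \<gamma> ` ?P. 2)"
    proof -
      have "sum g ?P = (\<Sum>c \<in> \<gamma> ` ?P. sum g {e \<in> ?P. \<gamma> e = c})"
        using fin by (intro sum.image_gen) auto
      also have "\<dots> \<le> (\<Sum>c \<in> \<gamma> ` ?P. 2)"
      proof (rule sum_mono)
        fix c
        have "sum g {e \<in> ?P. \<gamma> e = c} \<le> sum g {e \<in> E. \<gamma> e = c}"
          using fin nonneg by (intro sum_mono2) auto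
        then show "sum g {e \<in> ?P. \<gamma> e = c} \<le> 2" using degC[of c] by linarith
      qed
      finally show ?thesis .
    qed
    moreover have "sum g ?Q \<le> (\<Sum>b \<in> \<beta> ` ?Q. real k)"
    proof -
      have "sum g ?Q = (\<Sum>b \<in> \<beta> ` ?Q. sum g {e \<in> ?Q. \<beta> e = b})"
        using fin by (intro sum.image_gen) auto
      also have "\<dots> \<le> (\<Sum>b \<in> \<beta> ` ?Q. real k)"
      proof (rule sum_mono)
        fix b
        have "sum g {e \<in> ?Q. \<beta> e = b} \<le> sum g {e \<in> E. \<beta> e = b}"
          using fin nonneg by (intro sum_mono2) auto
        then show "sum g {e \<in> ?Q. \<beta> e = b} \<le> real k" using degB[of b] by linarith
      qed
      finally show ?thesis .
    qed
    moreover have "\<beta> ` ?Q = \<beta> ` E - X" by auto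
    ultimately have "sum g E \<le> real (k * card (\<beta> ` E - X) + 2 * card (\<gamma> ` ?P))"
      by (simp add: mult.commute)
    then have "\<lceil>sum g E\<rceil> \<le> int (k * card (\<beta> ` E - X) + 2 * card (\<gamma> ` ?P))"
      by (simp only: ceiling_le_iff of_int_of_nat_eq)
    then show ?thesis unfolding card\<gamma> B by linarith
  qed
  have "\<exists>G \<subseteq> ?E. inj_on ?\<gamma> G \<and> (\<forall>b. card {x \<in> G. ?\<beta> x = b} \<le> k) \<and> nat \<lceil>sum g E\<rceil> \<le> card G"
    by (rule capacitated_hall[OF finE hall])
  then obtain G where G: "G \<subseteq> ?E" "inj_on ?\<gamma> G" "\<And>b. card {x \<in> G. ?\<beta> x = b} \<le> k"
    "nat \<lceil>sum g E\<rceil> \<le> card G" by auto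
  define w where "w e = card {i. (e, i) \<in> G}" for e
  have sumw: "sum w S = card {x \<in> G. fst x \<in> S}" if "S \<subseteq> E" for S
  proof -
    have "{x \<in> G. fst x \<in> S} = Sigma S (\<lambda>e. {i. (e, i) \<in> G})" by auto
    then show ?thesis using finite_subset[OF that fin] by (simp add: w_def card_SigmaI)
  qed
  have "sum w {e \<in> E. \<beta> e = b} \<le> k" for b
  proof -
    have "{x \<in> G. fst x \<in> {e \<in> E. \<beta> e = b}} = {x \<in> G. ?\<beta> x = b}" using G(1) by auto
    then show ?thesis using G(3)[of b] by (subst sumw) auto
  qed
  moreover have "sum w {e \<in> E. \<gamma> e = c} \<le> 2" for c
  proof -
    let ?T = "{x \<in> G. fst x \<in> {e \<in> E. \<gamma> e = c}}"
    have "card ?T = card (?\<gamma> ` ?T)" by (rule card_image[symmetric]) (rule inj_on_subset[OF G(2)], auto)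
    also have "\<dots> \<le> card ({c} \<times> (UNIV :: bool set))" by (intro card_mono) auto
    finally show ?thesis by (subst sumw) (auto simp: card_cartesian_product)
  qed
  moreover have "sum g E \<le> real (sum w E)"
  proof -
    have "{x \<in> G. fst x \<in> E} = G" using G(1) by auto
    then have "sum w E = card G" by (subst sumw) auto
    then show ?thesis using G(4) by linarith
  qed
  ultimately show ?thesis by blast
qed

section \<open>Matchings in tripartite hypergraphs\<close>

text \<open>Deficiency is absorbed by \<open>d\<close> dummy cliques, each containing one vertex of every colour:
  a rainbow independent set contains at most \<open>d\<close> dummies.\<close>

definition dummy_graph :: "'e rel \<Rightarrow> ('e + 'c \<times> nat) rel" where
  "dummy_graph E = map_prod Inl Inl ` E \<union>
     {(Inr (a, i), Inr (a', i)) | a a' i. a \<noteq> a'}"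

lemma dummy_graph_iff [simp]:
  "(Inl e, Inl e') \<in> dummy_graph E \<longleftrightarrow> (e, e') \<in> E"
  "(Inl e, Inr p) \<notin> dummy_graph E" "(Inr p, Inl e) \<notin> dummy_graph E"
  "(Inr (a, i), Inr (a', i')) \<in> dummy_graph E \<longleftrightarrow> a \<noteq> a' \<and> i = i'"
  by (auto simp: dummy_graph_def)

lemma sym_dummy_graph: "sym E \<Longrightarrow> sym (dummy_graph E)"
  by (auto simp: dummy_graph_def sym_def)

lemma irrefl_dummy_graph: "irrefl E \<Longrightarrow> irrefl (dummy_graph E)"
  by (auto simp: dummy_graph_def irrefl_def)

text \<open>The deficiency form of the topological Hall theorem: each dummy clique makes up for one
  missing degree of acyclicity and costs at most one colour. The ground set \<open>U\<close> is
  arbitrary because it must later contain the dummies.\<close>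

lemma partial_rainbow_independent_set:
  fixes V :: "'e set" and col :: "'e \<Rightarrow> 'c"
  assumes finA: "finite A" and finV: "finite V" and symE: "sym E" and irr: "irrefl E"
    and acyc: "\<And>I U. I \<subseteq> A \<Longrightarrow> finite U \<Longrightarrow> Inl ` V \<subseteq> U \<Longrightarrow>
      acyclic_upto U (card I - d) (indep_sets (Inl ` colour_restrict col V I) (dummy_graph E :: ('e + 'c \<times> nat) rel))"
  shows "\<exists>s \<in> indep_sets V E. inj_on col s \<and> card s = card A - d"
proof -
  let ?E = "dummy_graph E :: ('e + 'c \<times> nat) rel"
  let ?V = "Inl ` V \<union> Inr ` (A \<times> {..<d}) :: ('e + 'c \<times> nat) set"
  let ?col = "case_sum col fst :: 'e + 'c \<times> nat \<Rightarrow> 'c"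
  have fin: "finite ?V" using finA finV by simp
  have "acyclic_upto ?V (card I) (indep_sets (colour_restrict ?col ?V I) ?E)" if I: "I \<subseteq> A" for I
  proof (cases "I = {}")
    case True
    then show ?thesis by (simp add: acyclic_upto_def)
  next
    case False
    let ?W = "Inl ` colour_restrict col V I :: ('e + 'c \<times> nat) set"
    have sub: "?W \<union> Inr ` (I \<times> {..<i}) \<subseteq> ?V" if "i \<le> d" for i
      using that I by (auto simp: colour_restrict_def)
    have step: "acyclic_upto ?V (card I - d + i) (indep_sets (?W \<union> Inr ` (I \<times> {..<i})) ?E)" if "i \<le> d" for i
      using that
    proof (induction i)
      case 0
      show ?case using acyc[OF I fin] by simp
    next
      case (Suc i)
      have split: "?W \<union> Inr ` (I \<times> {..<Suc i}) = (?W \<union> Inr ` (I \<times> {..<i})) \<union> Inr ` (I \<times> {i})"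
        by (auto simp: lessThan_Suc)
      have "acyclic_upto ?V (Suc (card I - d + i))
          (indep_sets ((?W \<union> Inr ` (I \<times> {..<i})) \<union> Inr ` (I \<times> {i})) ?E)"
      proof (rule acyclic_upto_add_clique[OF fin])
        show "(?W \<union> Inr ` (I \<times> {..<i})) \<union> Inr ` (I \<times> {i}) \<subseteq> ?V"
          using sub[OF Suc.prems] unfolding split .
        show "acyclic_upto ?V (card I - d + i) (indep_sets (?W \<union> Inr ` (I \<times> {..<i})) ?E)"
          using Suc by simp
      qed (use False sym_dummy_graph[OF symE] irrefl_dummy_graph[OF irr] in auto)
      then show ?case unfolding split by simp
    qed
    have "colour_restrict ?col ?V I = ?W \<union> Inr ` (I \<times> {..<d})"
      using I by (auto simp: colour_restrict_def)
    then show ?thesis using step[of d] by (auto intro: acyclic_upto_mono)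
  qed
  from rainbow_independent_set[OF finA fin subset_refl this]
  obtain s where s: "s \<in> indep_sets ?V ?E" "?col ` s = A" "card s = card A" by blast
  have fins: "finite s" using s(1) finite_subset[OF _ fin] by (auto simp: indep_sets_def)
  have inj: "inj_on ?col s" using fins s by (simp add: eq_card_imp_inj_on)
  define S where "S = {e. Inl e \<in> s}"
  define T where "T = {p. Inr p \<in> s}"
  have sST: "s = Inl ` S \<union> Inr ` T"
  proof (rule set_eqI)
    fix x show "x \<in> s \<longleftrightarrow> x \<in> Inl ` S \<union> Inr ` T" by (cases x) (auto simp: S_def T_def)
  qed
  have finST: "finite S" "finite T" using fins unfolding sST by (auto dest: finite_imageD)
  \<comment> \<open>Dummies with the same index are pairwise adjacent, so an independent set takes
    at most one from each of the \<open>d\<close> cliques.\<close>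
  have "inj_on snd T"
  proof (rule inj_onI)
    fix p q assume pq: "p \<in> T" "q \<in> T" "snd p = snd q"
    then have "(Inr p, Inr q) \<notin> ?E" using s(1) by (auto simp: T_def indep_sets_def)
    then show "p = q" using pq by (cases p; cases q) auto
  qed
  then have "card T = card (snd ` T)" by (simp add: card_image)
  also have "\<dots> \<le> card {..<d}"
    using s(1) by (intro card_mono) (auto simp: T_def indep_sets_def)
  finally have "card T \<le> d" by simp
  moreover have "card s = card S + card T"
    unfolding sST using finST by (subst card_Un_disjoint) (auto simp: card_image)
  ultimately have "card A - d \<le> card S" using s(3) by linarith
  then obtain S' where S': "S' \<subseteq> S" "card S' = card A - d" by (meson obtain_subset_with_card_n)
  have "S' \<in> indep_sets V E"
    unfolding indep_sets_def
  proof (intro CollectI conjI subsetI ballI)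
    fix x assume "x \<in> S'"
    then have "Inl x \<in> ?V" using S'(1) s(1) by (auto simp: S_def indep_sets_def)
    then show "x \<in> V" by auto
  next
    fix x y assume "x \<in> S'" "y \<in> S'"
    then have "(Inl x, Inl y) \<notin> ?E" using S'(1) s(1) unfolding S_def indep_sets_def by blast
    then show "(x, y) \<notin> E" by simp
  qed
  moreover have "inj_on col S'"
  proof (rule inj_onI)
    fix x y assume "x \<in> S'" "y \<in> S'" "col x = col y"
    then show "x = y" using inj_onD[OF inj, of "Inl x" "Inl y"] S'(1) by (auto simp: S_def)
  qed
  ultimately show ?thesis using S'(2) by blast
qed

text \<open>In the conflict graph of \<beta> and \<gamma>, coloured by \<alpha>, a rainbow
  independent set is a matching. The edges with colours in \<open>I\<close> have total weight
  \<open>card I * D\<close>, and giving up \<open>d\<close> colours leaves the claimed size.\<close>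

theorem rainbow_matching:
  fixes g :: "'e \<Rightarrow> real" and \<alpha> :: "'e \<Rightarrow> 'c" and \<beta> :: "'e \<Rightarrow> 'b" and \<gamma> :: "'e \<Rightarrow> 'd" and D :: real
  assumes fin: "finite H" and finA: "finite A" and nonneg: "\<And>e. e \<in> H \<Longrightarrow> g e \<ge> 0"
    and degA: "\<And>a. a \<in> A \<Longrightarrow> sum g {e \<in> H. \<alpha> e = a} = D" and Dk: "D \<le> real k"
    and degB: "\<And>b. sum g {e \<in> H. \<beta> e = b} \<le> real k"
    and degC: "\<And>c. sum g {e \<in> H. \<gamma> e = c} \<le> 2"
  shows "\<exists>M \<subseteq> H. card M = nat \<lceil>real (card A) * D / (real k + 2)\<rceil> \<and>
    inj_on \<alpha> M \<and> inj_on \<beta> M \<and> inj_on \<gamma> M"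
proof -
  define E where "E = {(e, e'). e \<noteq> e' \<and> (\<beta> e = \<beta> e' \<or> \<gamma> e = \<gamma> e')}"
  define m where "m = nat \<lceil>real (card A) * D / (real k + 2)\<rceil>"
  define d where "d = card A - m"
  have symE: "sym E" and irr: "irrefl E" by (auto simp: E_def sym_def irrefl_def)
  have "real (card A) * D / (real k + 2) \<le> real (card A)"
    using Dk by (simp add: divide_le_eq mult_left_mono)
  then have mA: "m \<le> card A" unfolding m_def by linarith
  have D0: "D \<ge> 0" if "A \<noteq> {}"
    using that degA nonneg by (metis (mono_tags, lifting) ex_in_conv mem_Collect_eq sum_nonneg)
  have "acyclic_upto U (card I - d) (indep_sets (Inl ` colour_restrict \<alpha> H I) (dummy_graph E :: ('e + 'c \<times> nat) rel))"
    if I: "I \<subseteq> A" and finU: "finite U" and HU: "Inl ` H \<subseteq> U" for I and U :: "('e + 'c \<times> nat) set"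
  proof (cases "card I - d")
    case 0
    then show ?thesis by (simp add: acyclic_upto_def)
  next
    case (Suc j)
    let ?H = "colour_restrict \<alpha> H I"
    have finI: "finite I" using I finA finite_subset by blast
    have finH: "finite ?H" using fin by (simp add: colour_restrict_def)
    have le: "sum g {e \<in> ?H. P e} \<le> sum g {e \<in> H. P e}" for P
      using fin nonneg by (intro sum_mono2) (auto simp: colour_restrict_def)
    obtain w :: "'e \<Rightarrow> nat" where w: "\<And>b. sum w {e \<in> ?H. \<beta> e = b} \<le> k"
      "\<And>c. sum w {e \<in> ?H. \<gamma> e = c} \<le> 2" "sum g ?H \<le> real (sum w ?H)"
      using integral_edge_weights[OF finH, of g \<beta> k \<gamma>] nonneg
        order_trans[OF le degB] order_trans[OF le degC] by (auto simp: colour_restrict_def)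
    have "sum g ?H = (\<Sum>a \<in> I. sum g {e \<in> ?H. \<alpha> e = a})"
      using finH finI by (intro sum.group[symmetric]) (auto simp: colour_restrict_def)
    also have "\<dots> = (\<Sum>a \<in> I. D)"
    proof (rule sum.cong)
      fix a assume a: "a \<in> I"
      then have "{e \<in> ?H. \<alpha> e = a} = {e \<in> H. \<alpha> e = a}" by (auto simp: colour_restrict_def)
      then show "sum g {e \<in> ?H. \<alpha> e = a} = D" using degA a I by auto
    qed simp
    finally have tot: "real (card I) * D \<le> real (sum w ?H)" using w(3) by simp
    \<comment> \<open>Rounding up adds less than one, which settles \<open>I = A\<close>. Each
      colour missing from \<open>I\<close> lowers the left side by \<open>k + 2\<close> but the
      guaranteed weight \<open>card I * D\<close> only by \<open>D\<close>, which is at most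
      \<open>k\<close>.\<close>
    have bound: "(k + 2) * (card I - d) < sum w ?H + (k + 2)"
    proof -
      have IA: "card I \<le> card A" using card_mono[OF finA I] .
      have "A \<noteq> {}" using Suc I by auto
      then have "real m < real (card A) * D / (real k + 2) + 1"
        using D0 unfolding m_def by (simp add: ceiling_less_iff) linarith
      then have "real m - 1 < real (card A) * D / (real k + 2)" by simp
      then have "(real m - 1) * (real k + 2) < real (card A) * D"
        by (subst (asm) pos_less_divide_eq) auto
      moreover have "(real (card A) - real (card I)) * D \<le> (real (card A) - real (card I)) * (real k + 2)"
        using IA Dk by (intro mult_left_mono) auto
      moreover have cd: "real (card I - d) = real (card I) - real (card A) + real m"
        using Suc mA unfolding d_def by linarith
      ultimately have "(real k + 2) * real (card I - d) < real (card I) * D + (real k + 2)"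
        unfolding cd by (simp add: algebra_simps)
      then have "(real k + 2) * real (card I - d) < real (sum w ?H) + (real k + 2)"
        using tot by linarith
      then have "real ((k + 2) * (card I - d)) < real (sum w ?H + (k + 2))"
        by (simp only: of_nat_mult of_nat_add of_nat_numeral)
      then show ?thesis unfolding of_nat_less_iff .
    qed
    let ?w = "case_sum w (\<lambda>_. 0) :: 'e + 'c \<times> nat \<Rightarrow> nat"
    let ?\<beta> = "\<lambda>x. \<beta> (projl x)" and ?\<gamma> = "\<lambda>x. \<gamma> (projl x)"
    have sumw: "sum ?w {x \<in> Inl ` ?H. P (projl x)} = sum w {e \<in> ?H. P e}" for P
    proof -
      have "{x \<in> Inl ` ?H. P (projl x)} = (Inl ` {e \<in> ?H. P e} :: ('e + 'c \<times> nat) set)" by auto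
      then show ?thesis by (simp add: sum.reindex)
    qed
    show ?thesis
    proof (rule acyclic_upto_line_graph[OF finU, where w = ?w and \<beta> = ?\<beta> and \<gamma> = ?\<gamma> and k = k])
      show "Inl ` ?H \<subseteq> U" using HU by (auto simp: colour_restrict_def)
      show "sum ?w {x \<in> Inl ` ?H. ?\<beta> x = b} \<le> k" for b using w(1) sumw[of "\<lambda>e. \<beta> e = b"] by simp
      show "sum ?w {x \<in> Inl ` ?H. ?\<gamma> x = c} \<le> 2" for c using w(2) sumw[of "\<lambda>e. \<gamma> e = c"] by simp
      show "(k + 2) * (card I - d) < sum ?w (Inl ` ?H) + (k + 2)" using bound by (simp add: sum.reindex)
    qed (use sym_dummy_graph[OF symE] irrefl_dummy_graph[OF irr] in \<open>auto simp: E_def\<close>)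
  qed
  from partial_rainbow_independent_set[OF finA fin symE irr this]
  obtain M where M: "M \<in> indep_sets H E" "inj_on \<alpha> M" "card M = card A - d" by blast
  have "card M = m" using M(3) mA by (simp add: d_def)
  moreover have "inj_on \<beta> M" "inj_on \<gamma> M" "M \<subseteq> H"
    using M(1) by (auto simp: indep_sets_def E_def inj_on_def)
  ultimately show ?thesis using M(2) unfolding m_def by blast
qed

section \<open>From balanced functions to matchings\<close>

lemma tripartite_edge_vertices:
  assumes "kpartite H [A, B, C]"
  shows "\<exists>\<alpha> \<beta> \<gamma>. \<forall>e \<in> H. e \<inter> A = {\<alpha> e} \<and> e \<inter> B = {\<beta> e} \<and> e \<inter> C = {\<gamma> e}"
proof -
  have "\<forall>e \<in> H. card (e \<inter> A) = 1 \<and> card (e \<inter> B) = 1 \<and> card (e \<inter> C) = 1"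
    using assms by (simp add: kpartite_def All_less_Suc numeral_3_eq_3)
  then have "\<forall>e \<in> H. \<exists>a b c. e \<inter> A = {a} \<and> e \<inter> B = {b} \<and> e \<inter> C = {c}"
    by (metis card_1_singletonE)
  then show ?thesis by metis
qed

lemma sum_deg_side:
  assumes "finite H" "finite A" and \<alpha>: "\<And>e. e \<in> H \<Longrightarrow> e \<inter> A = {\<alpha> e}"
  shows "(\<Sum>a \<in> A. deg H f a) = sum f H"
    and "a \<in> A \<Longrightarrow> deg H f a = sum f {e \<in> H. \<alpha> e = a}"
proof -
  have eq: "deg H f a = sum f {e \<in> H. \<alpha> e = a}" if "a \<in> A" for a
  proof -
    have "a \<in> e \<longleftrightarrow> \<alpha> e = a" if "e \<in> H" for e using \<alpha>[OF that] \<open>a \<in> A\<close> by (metis Int_iff singleton_iff)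
    then show ?thesis unfolding deg_def by (intro sum.cong) auto
  qed
  then show "a \<in> A \<Longrightarrow> deg H f a = sum f {e \<in> H. \<alpha> e = a}" .
  have "(\<Sum>a \<in> A. deg H f a) = (\<Sum>a \<in> A. sum f {e \<in> H. \<alpha> e = a})" by (simp add: eq)
  also have "\<dots> = sum f H" using assms by (intro sum.group) blast+
  finally show "(\<Sum>a \<in> A. deg H f a) = sum f H" .
qed

text \<open>Scaling the balanced function to degree \<open>D\<close> on the sides of size
  \<open>n\<close> gives degree \<open>n * D / p\<close> on the third side, which \<open>Dp\<close>
  bounds by \<open>2\<close>.\<close>

lemma bm_arrow_tripartite:
  fixes n p k :: nat and D :: real
  assumes "n \<ge> 1" "p \<ge> 1" and D: "0 \<le> D" "D \<le> real k" and Dp: "real n * D \<le> 2 * real p"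
  shows "bm_arrow TYPE('a) [n, n, p] (nat \<lceil>real n * D / (real k + 2)\<rceil>)"
  unfolding bm_arrow_def
proof (intro allI impI)
  fix H :: "'a set set" assume "fractionally_balanced [n, n, p] H"
  then obtain Vs f where Vs: "kpartite H Vs" "map card Vs = [n, n, p]"
    and f: "\<forall>e \<in> H. f e \<ge> 0" "\<exists>e \<in> H. f e \<noteq> 0" "balanced H Vs f"
    unfolding fractionally_balanced_def by (elim exE conjE) (rule that)
  obtain A B C where ABC: "Vs = [A, B, C]" and card: "card A = n" "card B = n" "card C = p"
    using Vs(2) by (auto simp: map_eq_Cons_conv)
  have fin: "finite H" using Vs by (simp add: kpartite_def)
  have fins: "finite A" "finite B" "finite C" using card assms by (auto intro: card_ge_0_finite)
  obtain \<alpha> \<beta> \<gamma> where abc: "\<And>e. e \<in> H \<Longrightarrow> e \<inter> A = {\<alpha> e}" "\<And>e. e \<in> H \<Longrightarrow> e \<inter> B = {\<beta> e}"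
    "\<And>e. e \<in> H \<Longrightarrow> e \<inter> C = {\<gamma> e}"
    using tripartite_edge_vertices Vs(1) unfolding ABC by metis
  define W where "W = sum f H"
  have "W > 0"
    using f(1,2) fin unfolding W_def by (metis less_eq_real_def sum_pos2)
  have bal: "\<exists>c. \<forall>v \<in> A. deg H f v = c" "\<exists>c. \<forall>v \<in> B. deg H f v = c" "\<exists>c. \<forall>v \<in> C. deg H f v = c"
    using f(3) unfolding balanced_def ABC by (auto simp: All_less_Suc numeral_3_eq_3)
  \<comment> \<open>Double counting fixes the constant degree on a side; the value \<open>0\<close>
    elsewhere gives degree bounds for every element of the vertex type.\<close>
  have side: "sum f {e \<in> H. \<phi> e = v} = (if v \<in> S then W / real (card S) else 0)"
    if S: "finite S" "card S \<ge> 1" "\<And>e. e \<in> H \<Longrightarrow> e \<inter> S = {\<phi> e}" "\<exists>c. \<forall>v \<in> S. deg H f v = c" for S \<phi> v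
  proof (cases "v \<in> S")
    case True
    obtain c where c: "\<forall>v \<in> S. deg H f v = c" using S(4) by blast
    have "real (card S) * c = W" using sum_deg_side(1)[OF fin S(1,3), where f = f] c by (simp add: W_def)
    then have "c = W / real (card S)" using S(2) by (auto simp: field_simps)
    then show ?thesis using True c sum_deg_side(2)[OF fin S(1,3) True, where f = f] by simp
  next
    case False
    have "\<phi> e \<in> S" if "e \<in> H" for e using S(3)[OF that] by blast
    then have empty: "{e \<in> H. \<phi> e = v} = {}" using False by auto
    show ?thesis unfolding empty using False by simp
  qed
  have degs: "sum f {e \<in> H. \<alpha> e = v} = (if v \<in> A then W / real n else 0)"
    "sum f {e \<in> H. \<beta> e = v} = (if v \<in> B then W / real n else 0)"
    "sum f {e \<in> H. \<gamma> e = v} = (if v \<in> C then W / real p else 0)" for v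
    using side[of A \<alpha> v] side[of B \<beta> v] side[of C \<gamma> v] fins card abc bal assms by simp_all
  define g where "g e = real n * D / W * f e" for e
  have sum_g: "sum g S = real n * D / W * sum f S" for S
    unfolding g_def by (rule sum_distrib_left[symmetric])
  have n0: "real n > 0" "real p > 0" using assms by auto
  have "\<exists>M \<subseteq> H. card M = nat \<lceil>real (card A) * D / (real k + 2)\<rceil> \<and> inj_on \<alpha> M \<and> inj_on \<beta> M \<and> inj_on \<gamma> M"
  proof (rule rainbow_matching[where g = g, OF fin fins(1)])
    show "g e \<ge> 0" if "e \<in> H" for e using f(1) that D \<open>W > 0\<close> by (simp add: g_def)
    show "sum g {e \<in> H. \<alpha> e = a} = D" if "a \<in> A" for a
      unfolding sum_g degs
      using that \<open>W > 0\<close> n0 by simp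
    show "sum g {e \<in> H. \<beta> e = b} \<le> real k" for b
      unfolding sum_g degs
      using \<open>W > 0\<close> n0 D by simp
    show "sum g {e \<in> H. \<gamma> e = c} \<le> 2" for c
      unfolding sum_g degs
      using \<open>W > 0\<close> n0 Dp by (simp add: divide_le_eq)
  qed (use D in auto)
  then obtain M where M: "M \<subseteq> H" "card M = nat \<lceil>real n * D / (real k + 2)\<rceil>"
    "inj_on \<alpha> M" "inj_on \<beta> M" "inj_on \<gamma> M" unfolding card by blast
  \<comment> \<open>Edges lie in the union of the sides and meet each side in one vertex, so
    differing there on every side means being disjoint.\<close>
  have "disjoint M"
  proof (rule disjointI)
    fix e e' assume e: "e \<in> M" "e' \<in> M" "e \<noteq> e'"
    then have "\<alpha> e \<noteq> \<alpha> e'" "\<beta> e \<noteq> \<beta> e'" "\<gamma> e \<noteq> \<gamma> e'" using M by (auto simp: inj_on_def)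
    moreover have "e \<subseteq> A \<union> B \<union> C" using e M(1) Vs(1) unfolding ABC kpartite_def by auto
    moreover have "x \<notin> e'" if "x \<in> e" "x \<in> S" "e \<inter> S = {u}" "e' \<inter> S = {u'}" "u \<noteq> u'" for x S u u'
    proof
      assume "x \<in> e'"
      then have "x \<in> {u}" "x \<in> {u'}" using that(1,2) unfolding that(3,4)[symmetric] by simp_all
      then show False using that(5) by simp
    qed
    moreover have "e \<in> H" "e' \<in> H" using e M(1) by auto
    ultimately have "x \<notin> e'" if "x \<in> e" for x
      using abc[of e] abc[of e'] that by (metis Un_iff subsetD)
    then show "e \<inter> e' = {}" by blast
  qed
  then show "\<exists>M. matching H M \<and> card M = nat \<lceil>real n * D / (real k + 2)\<rceil>"
    using M by (auto simp: matching_def)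
qed

theorem theorem4p6:
  fixes n :: nat and r :: real
  assumes "n \<ge> 1" and "r \<ge> 1" and "r * real n \<in> \<int>"
  shows "bm_arrow TYPE('a) [n, n, nat \<lfloor>r * real n\<rfloor>]
           (nat \<lceil>(real_of_int \<lfloor>2 * r\<rfloor> * real n) / (real_of_int \<lfloor>2 * r\<rfloor> + 2)\<rceil>) \<and>
         bm_arrow TYPE('a) [n, n, nat \<lfloor>r * real n\<rfloor>]
           (nat \<lceil>(2 * r * real n) / (real_of_int \<lceil>2 * r\<rceil> + 2)\<rceil>)"
proof -
  let ?p = "nat \<lfloor>r * real n\<rfloor>"
  have rn: "1 \<le> r * real n" using mult_mono[of 1 r 1 "real n"] assms by simp
  have p: "real ?p = r * real n" using assms(3) rn by (auto elim!: Ints_cases)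
  then have p1: "?p \<ge> 1" using rn by linarith
  have k: "real (nat \<lfloor>2 * r\<rfloor>) = real_of_int \<lfloor>2 * r\<rfloor>" "real (nat \<lceil>2 * r\<rceil>) = real_of_int \<lceil>2 * r\<rceil>"
    using assms(2) by simp_all
  have floor_le: "real n * real_of_int \<lfloor>2 * r\<rfloor> \<le> 2 * real ?p"
    unfolding p using mult_left_mono[OF of_int_floor_le[of "2 * r"], of "real n"] by (simp add: mult_ac)
  \<comment> \<open>Part (a) takes \<open>D = k\<close>, the floor of \<open>2 * r\<close>.\<close>
  have "bm_arrow TYPE('a) [n, n, ?p]
      (nat \<lceil>real n * real_of_int \<lfloor>2 * r\<rfloor> / (real (nat \<lfloor>2 * r\<rfloor>) + 2)\<rceil>)"
    by (rule bm_arrow_tripartite[OF assms(1) p1]) (use assms(2) floor_le in \<open>auto simp: k\<close>)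
  \<comment> \<open>Part (b) uses the full degree \<open>D = 2 * r\<close>, so that the third side
    has degree exactly \<open>2\<close>, and rounds only the capacity \<open>k\<close> up.\<close>
  moreover have "bm_arrow TYPE('a) [n, n, ?p] (nat \<lceil>real n * (2 * r) / (real (nat \<lceil>2 * r\<rceil>) + 2)\<rceil>)"
  proof (rule bm_arrow_tripartite[OF assms(1) p1])
    show "2 * r \<le> real (nat \<lceil>2 * r\<rceil>)" unfolding k by (rule le_of_int_ceiling)
    show "real n * (2 * r) \<le> 2 * real ?p" unfolding p by simp
  qed (use assms(2) in simp)
  ultimately show ?thesis unfolding k by (simp only: mult.commute[of "real n"])
qed

end
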